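(* Let $F^z_0$ be the problem of minimizing $\sum_{j\in P}\omega_j\theta_j$ over all $(x,z,\theta)$ with $x\in Q$, $z\in\{0,1\}^{p\times p}$, $\theta\in\mathbb{R}^p$ satisfying $\sum_{i\in P}z_{ij}=1$ for all $j\in P$; $\sum_{j\in P}z_{ij}=1$ for all $i\in P$; $C^i x\le \theta_j+M(1-z_{ij})$ for all $i,j\in P$; $\theta_j\ge\theta_{j+1}$ for all $j\in P$, $j<p$. Let $F^{zy}_0$ be the problem of minimizing $\sum_{j\in P}\omega_j\sum_{i\in P}y_{ij}$ over all $(x,y,z)$ with $x\in Q$, $z\in\{0,1\}^{p\times p}$, $y\in\mathbb{R}^{p\times p}$ satisfying $\sum_{i\in P}z_{ij}=1$ for all $j\in P$; $\sum_{j\in P}z_{ij}=1$ for all $i\in P$; $C^i x\le \sum_{i'\in P}y_{i'j}+M(1-z_{ij})$ for all $i,j\in P$; $\sum_{i\in P}y_{ij}\ge\sum_{i\in P}y_{i,j+1}$ for all $j\in P$, $j<p$. Then for each optimal solution $(x^*,y^*,z^* )$ to $F^{zy}_0$ there exists an optimal solution $(x^*,z^*,\theta^* )$ to $F^z_0$, and conversely (for each optimal solution $(x^*,z^*,\theta^* )$ to $F^z_0$ there exists an optimal solution $(x^*,y^*,z^* )$ to $F^{zy}_0$). Moreover, $\sum_{j\in P}\omega_j\sum_{i\in P}y^*_{ij}=\sum_{j\in P}\omega_j\theta^*_j$.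
   Context: $P=\{1,\dots,p\}$. $Q\subseteq\mathbb{R}^n$ is the feasible set of a combinatorial optimization problem (a combinatorial object representable by a system of linear inequalities). $C\in\mathbb{R}^{p\times n}$ is a matrix whose rows $C^i$, $i\in P$, are the cost vectors of $p$ objective (cost) functions $x\mapsto C^i x$. $\omega=(\omega_j)_{j\in P}$ is a vector of non-negative weights. $M$ is a non-negative upper bound on the value of all the cost functions, i.e. $M\ge 0$ and $C^i x\le M$ for all $x\in Q$, $i\in P$. *)

theory Defs
  imports "HOL-Analysis.Analysis"
begin

text \<open>
  With \<open>P = {1..p}\<close>, the spaces of real \<open>p\<close>-vectors and real \<open>p \<times> p\<close> matrices are the extensional
  function spaces \<open>P \<rightarrow>\<^sub>E UNIV\<close> and \<open>P \<times> P \<rightarrow>\<^sub>E UNIV\<close>: values outside the index set are fixed, so a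
  solution has exactly the intended components. The row \<open>C\<^sup>i\<close> of the cost matrix is \<open>C i\<close>; only
  \<open>C i\<close> with \<open>i \<in> P\<close> matters.
\<close>

definition feasible_z ::
  "nat \<Rightarrow> (real^'n) set \<Rightarrow> (nat \<Rightarrow> real^'n) \<Rightarrow> real \<Rightarrow>
    ((real^'n) \<times> (nat \<times> nat \<Rightarrow> real) \<times> (nat \<Rightarrow> real)) set" where
  "feasible_z p Q C M = {(x, z, \<theta>).
     x \<in> Q \<and> z \<in> {1..p} \<times> {1..p} \<rightarrow>\<^sub>E {0, 1} \<and> \<theta> \<in> {1..p} \<rightarrow>\<^sub>E UNIV \<and>
     (\<forall>j\<in>{1..p}. (\<Sum>i\<in>{1..p}. z (i, j)) = 1) \<and>
     (\<forall>i\<in>{1..p}. (\<Sum>j\<in>{1..p}. z (i, j)) = 1) \<and>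
     (\<forall>i\<in>{1..p}. \<forall>j\<in>{1..p}. C i \<bullet> x \<le> \<theta> j + M * (1 - z (i, j))) \<and>
     (\<forall>j\<in>{1..p}. j < p \<longrightarrow> \<theta> j \<ge> \<theta> (j + 1))}"

definition objective_z ::
  "nat \<Rightarrow> (nat \<Rightarrow> real) \<Rightarrow> (real^'n) \<times> (nat \<times> nat \<Rightarrow> real) \<times> (nat \<Rightarrow> real) \<Rightarrow> real" where
  "objective_z p \<omega> = (\<lambda>(x, z, \<theta>). \<Sum>j\<in>{1..p}. \<omega> j * \<theta> j)"

definition optimal_z ::
  "nat \<Rightarrow> (real^'n) set \<Rightarrow> (nat \<Rightarrow> real^'n) \<Rightarrow> (nat \<Rightarrow> real) \<Rightarrow> real \<Rightarrow>
    (real^'n) \<times> (nat \<times> nat \<Rightarrow> real) \<times> (nat \<Rightarrow> real) \<Rightarrow> bool" where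
  "optimal_z p Q C \<omega> M = is_arg_min (objective_z p \<omega>) (\<lambda>s. s \<in> feasible_z p Q C M)"

definition feasible_zy ::
  "nat \<Rightarrow> (real^'n) set \<Rightarrow> (nat \<Rightarrow> real^'n) \<Rightarrow> real \<Rightarrow>
    ((real^'n) \<times> (nat \<times> nat \<Rightarrow> real) \<times> (nat \<times> nat \<Rightarrow> real)) set" where
  "feasible_zy p Q C M = {(x, y, z).
     x \<in> Q \<and> z \<in> {1..p} \<times> {1..p} \<rightarrow>\<^sub>E {0, 1} \<and> y \<in> {1..p} \<times> {1..p} \<rightarrow>\<^sub>E UNIV \<and>
     (\<forall>j\<in>{1..p}. (\<Sum>i\<in>{1..p}. z (i, j)) = 1) \<and>
     (\<forall>i\<in>{1..p}. (\<Sum>j\<in>{1..p}. z (i, j)) = 1) \<and>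
     (\<forall>i\<in>{1..p}. \<forall>j\<in>{1..p}.
        C i \<bullet> x \<le> (\<Sum>i'\<in>{1..p}. y (i', j)) + M * (1 - z (i, j))) \<and>
     (\<forall>j\<in>{1..p}. j < p \<longrightarrow>
        (\<Sum>i\<in>{1..p}. y (i, j)) \<ge> (\<Sum>i\<in>{1..p}. y (i, j + 1)))}"

definition objective_zy ::
  "nat \<Rightarrow> (nat \<Rightarrow> real) \<Rightarrow>
    (real^'n) \<times> (nat \<times> nat \<Rightarrow> real) \<times> (nat \<times> nat \<Rightarrow> real) \<Rightarrow> real" where
  "objective_zy p \<omega> = (\<lambda>(x, y, z). \<Sum>j\<in>{1..p}. \<omega> j * (\<Sum>i\<in>{1..p}. y (i, j)))"

definition optimal_zy ::
  "nat \<Rightarrow> (real^'n) set \<Rightarrow> (nat \<Rightarrow> real^'n) \<Rightarrow> (nat \<Rightarrow> real) \<Rightarrow> real \<Rightarrow>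
    (real^'n) \<times> (nat \<times> nat \<Rightarrow> real) \<times> (nat \<times> nat \<Rightarrow> real) \<Rightarrow> bool" where
  "optimal_zy p Q C \<omega> M = is_arg_min (objective_zy p \<omega>) (\<lambda>s. s \<in> feasible_zy p Q C M)"

end

(* Idea: sending (x, y, z) to (x, z, \<theta>), where \<theta> j is the j-th column sum of y, maps the
   feasible set of the second problem onto that of the first and preserves the objective. *)
theory Submission
  imports Defs
begin

text \<open>The second problem sees \<open>y\<close> only through its column sums, and these play
  exactly the role of \<open>\<theta>\<close>. Every vector \<open>\<theta>\<close> arises in this
  way (\<open>column_sums_surj\<close>), so the two problems attain the same objective values, and
  replacing \<open>y\<close> by its column sums preserves and reflects optimality
  (\<open>optimal_zy_iff\<close>). An optimal \<open>\<theta>\<close> or \<open>y\<close> is then an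
  image or a preimage under this map, with \<open>x\<close> and \<open>z\<close> untouched. The
  values agree because any two minimizers of one problem have the same value.\<close>

definition column_sums :: "nat \<Rightarrow> (nat \<times> nat \<Rightarrow> real) \<Rightarrow> nat \<Rightarrow> real" where
  "column_sums p y = (\<lambda>j\<in>{1..p}. \<Sum>i\<in>{1..p}. y (i, j))"

lemma column_sums_apply:
  "j \<in> {1..p} \<Longrightarrow> column_sums p y j = (\<Sum>i\<in>{1..p}. y (i, j))"
  by (simp add: column_sums_def)

lemma column_sums_surj:
  assumes "\<theta> \<in> {1..p} \<rightarrow>\<^sub>E UNIV"
  obtains y where "y \<in> {1..p} \<times> {1..p} \<rightarrow>\<^sub>E UNIV" and "column_sums p y = \<theta>"
proof
  \<comment> \<open>Spread \<open>\<theta> j\<close> evenly over the \<open>p\<close> rows; a column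
    index \<open>j\<close> exists only if \<open>p > 0\<close>, so the division is harmless.\<close>
  let ?y = "\<lambda>(i, j)\<in>{1..p} \<times> {1..p}. \<theta> j / real p"
  show "?y \<in> {1..p} \<times> {1..p} \<rightarrow>\<^sub>E UNIV"
    by (simp add: PiE_iff)
  show "column_sums p ?y = \<theta>"
  proof
    fix j
    \<comment> \<open>Off the index set both sides are \<open>undefined\<close>: the left by the
      restriction in \<open>column_sums\<close>, the right by extensionality of
      \<open>\<theta>\<close>.\<close>
    show "column_sums p ?y j = \<theta> j"
      using assms by (cases "j \<in> {1..p}") (auto simp: column_sums_def PiE_iff extensional_def)
  qed
qed

lemma feasible_zy_iff:
  "(x, y, z) \<in> feasible_zy p Q C M \<longleftrightarrow>
     y \<in> {1..p} \<times> {1..p} \<rightarrow>\<^sub>E UNIV \<and> (x, z, column_sums p y) \<in> feasible_z p Q C M"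
proof -
  have "column_sums p y \<in> {1..p} \<rightarrow>\<^sub>E UNIV"
    by (simp add: column_sums_def PiE_iff)
  \<comment> \<open>The guard \<open>j < p\<close> keeps \<open>j + 1\<close> in the index set,
    where \<open>column_sums\<close> is the actual sum.\<close>
  moreover have
    "(\<forall>j\<in>{1..p}. j < p \<longrightarrow> column_sums p y j \<ge> column_sums p y (j + 1)) \<longleftrightarrow>
     (\<forall>j\<in>{1..p}. j < p \<longrightarrow> (\<Sum>i\<in>{1..p}. y (i, j)) \<ge> (\<Sum>i\<in>{1..p}. y (i, j + 1)))"
    by (intro ball_cong imp_cong refl) (simp add: column_sums_apply)
  ultimately show ?thesis
    unfolding feasible_zy_def feasible_z_def by (auto simp: column_sums_apply)
qed

lemma objective_z_column_sums:
  "objective_z p \<omega> (x, z, column_sums p y) = objective_zy p \<omega> (x, y, z)"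
  by (simp add: objective_z_def objective_zy_def column_sums_apply)

text \<open>Optimality is feasibility plus the absence of a feasible point of smaller value. The
  first part transfers by \<open>feasible_zy_iff\<close>; the second agrees because a value below a
  given bound is attained in both problems or in neither.\<close>

lemma optimal_zy_iff:
  "optimal_zy p Q C \<omega> M (x, y, z) \<longleftrightarrow>
     y \<in> {1..p} \<times> {1..p} \<rightarrow>\<^sub>E UNIV \<and> optimal_z p Q C \<omega> M (x, z, column_sums p y)"
proof -
  have "(\<exists>s\<in>feasible_zy p Q C M. objective_zy p \<omega> s < c) \<longleftrightarrow>
        (\<exists>s\<in>feasible_z p Q C M. objective_z p \<omega> s < c)" for c
  proof
    assume "\<exists>s\<in>feasible_zy p Q C M. objective_zy p \<omega> s < c"
    then show "\<exists>s\<in>feasible_z p Q C M. objective_z p \<omega> s < c"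
      by (metis prod_cases3 feasible_zy_iff objective_z_column_sums)
  next
    assume "\<exists>s\<in>feasible_z p Q C M. objective_z p \<omega> s < c"
    then obtain x z \<theta> where s: "(x, z, \<theta>) \<in> feasible_z p Q C M" "objective_z p \<omega> (x, z, \<theta>) < c"
      by auto
    then have "\<theta> \<in> {1..p} \<rightarrow>\<^sub>E UNIV"
      by (simp add: feasible_z_def)
    \<comment> \<open>Surjectivity is what lifts a better point of the first problem to one of the
      second.\<close>
    then obtain y where "y \<in> {1..p} \<times> {1..p} \<rightarrow>\<^sub>E UNIV" "column_sums p y = \<theta>"
      by (rule column_sums_surj)
    with s show "\<exists>s\<in>feasible_zy p Q C M. objective_zy p \<omega> s < c"
      by (metis feasible_zy_iff objective_z_column_sums)
  qed
  then show ?thesis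
    unfolding optimal_zy_def optimal_z_def is_arg_min_def feasible_zy_iff objective_z_column_sums
    by blast
qed

theorem mainTheorem9:
  fixes p :: nat
    and Q :: "(real^'n) set"
    and C :: "nat \<Rightarrow> real^'n"
    and \<omega> :: "nat \<Rightarrow> real"
    and M :: real
  assumes "\<forall>j\<in>{1..p}. 0 \<le> \<omega> j"
    and "0 \<le> M"
    and "\<forall>x\<in>Q. \<forall>i\<in>{1..p}. C i \<bullet> x \<le> M"
  shows "(\<forall>x y z. optimal_zy p Q C \<omega> M (x, y, z) \<longrightarrow>
            (\<exists>\<theta>. optimal_z p Q C \<omega> M (x, z, \<theta>)))
       \<and> (\<forall>x z \<theta>. optimal_z p Q C \<omega> M (x, z, \<theta>) \<longrightarrow>
            (\<exists>y. optimal_zy p Q C \<omega> M (x, y, z)))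
       \<and> (\<forall>x y z \<theta>. optimal_zy p Q C \<omega> M (x, y, z) \<and> optimal_z p Q C \<omega> M (x, z, \<theta>) \<longrightarrow>
            (\<Sum>j\<in>{1..p}. \<omega> j * (\<Sum>i\<in>{1..p}. y (i, j))) = (\<Sum>j\<in>{1..p}. \<omega> j * \<theta> j))"
proof (intro conjI allI impI)
  fix x y z
  assume "optimal_zy p Q C \<omega> M (x, y, z)"
  then show "\<exists>\<theta>. optimal_z p Q C \<omega> M (x, z, \<theta>)"
    by (auto simp: optimal_zy_iff)
next
  fix x z \<theta>
  assume opt: "optimal_z p Q C \<omega> M (x, z, \<theta>)"
  then have "\<theta> \<in> {1..p} \<rightarrow>\<^sub>E UNIV"
    by (simp add: optimal_z_def is_arg_min_def feasible_z_def)
  then obtain y where "y \<in> {1..p} \<times> {1..p} \<rightarrow>\<^sub>E UNIV" "column_sums p y = \<theta>"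
    by (rule column_sums_surj)
  with opt show "\<exists>y. optimal_zy p Q C \<omega> M (x, y, z)"
    by (auto simp: optimal_zy_iff)
next
  fix x y z \<theta>
  assume "optimal_zy p Q C \<omega> M (x, y, z) \<and> optimal_z p Q C \<omega> M (x, z, \<theta>)"
  then have "optimal_z p Q C \<omega> M (x, z, column_sums p y)" "optimal_z p Q C \<omega> M (x, z, \<theta>)"
    by (auto simp: optimal_zy_iff)
  \<comment> \<open>Both points minimize over the same feasible set, so neither value is strictly
    below the other.\<close>
  then have "objective_z p \<omega> (x, z, column_sums p y) = objective_z p \<omega> (x, z, \<theta>)"
    unfolding optimal_z_def is_arg_min_def by (meson linorder_neqE)
  then show "(\<Sum>j\<in>{1..p}. \<omega> j * (\<Sum>i\<in>{1..p}. y (i, j))) = (\<Sum>j\<in>{1..p}. \<omega> j * \<theta> j)"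
    by (simp add: objective_z_column_sums) (simp add: objective_z_def objective_zy_def)
qed

end
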